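(* Let $R$ be a commutative Noetherian ring, $I$ an ideal of $R$ and $M$ a finitely generated $R$-module. Then the sequence $\mathcal{F}^I_M=\{r(I^n,M)\}_{n\geq 0}$ is a filtration of ideals of $R$, and it is also an $I$-filtration.
   Context: For submodules $A,B$ of $M$, $(A:B)=\{x\in R : xB\subseteq A\}$, and for an ideal $L$ of $R$, $r(L,M)=\bigcup_{k\geq 1}(L^{k+1}M:L^kM)$ (an ascending union of ideals). For $n\ge 1$ one has $r(I^n,M)=\bigcup_{k\geq 1}(I^{n+k}M:I^kM)$, and $r(I^0,M)=R$. A filtration of ideals is a sequence of ideals $R=I_0\supseteq I_1\supseteq I_2\supseteq\cdots$ with $I_nI_m\subseteq I_{n+m}$ for all $n,m$. It is an $I$-filtration if $I\,I_n\subseteq I_{n+1}$ for all $n\geq 0$. *)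

theory Defs
  imports "HOL-Algebra.Module" "HOL-Algebra.Ideal_Product" "HOL-Algebra.Ring_Divisibility"
begin

definition gen_submodule ::
  "('a, 'r) ring_scheme \<Rightarrow> ('a, 'b, 'm) module_scheme \<Rightarrow> 'b set \<Rightarrow> 'b set"
  where "gen_submodule R M S = \<Inter> {N. submodule N R M \<and> S \<subseteq> N}"

definition fin_gen_module ::
  "('a, 'r) ring_scheme \<Rightarrow> ('a, 'b, 'm) module_scheme \<Rightarrow> bool"
  where "fin_gen_module R M \<longleftrightarrow>
    (\<exists>S \<subseteq> carrier M. finite S \<and> carrier M = gen_submodule R M S)"

text \<open>This is the power in the monoid of ideals,
  whose unit is \<^term>\<open>carrier R\<close>, so the zeroth power is the whole ring.\<close>

definition ideal_pow :: "('a, 'r) ring_scheme \<Rightarrow> 'a set \<Rightarrow> nat \<Rightarrow> 'a set"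
  where "ideal_pow R L k = L [^]\<^bsub>ideals_set R\<^esub> k"

text \<open>The products \<open>ax\<close> alone need not be closed under addition, so \<open>LM\<close> is the submodule they
  generate, i.e. the set of their finite sums.\<close>

definition ideal_smult ::
  "('a, 'r) ring_scheme \<Rightarrow> ('a, 'b, 'm) module_scheme \<Rightarrow> 'a set \<Rightarrow> 'b set"
  where "ideal_smult R M L =
    gen_submodule R M {a \<odot>\<^bsub>M\<^esub> x | a x. a \<in> L \<and> x \<in> carrier M}"

definition submodule_colon ::
  "('a, 'r) ring_scheme \<Rightarrow> ('a, 'b, 'm) module_scheme \<Rightarrow> 'b set \<Rightarrow> 'b set \<Rightarrow> 'a set"
  where "submodule_colon R M A B = {x \<in> carrier R. (\<lambda>b. x \<odot>\<^bsub>M\<^esub> b) ` B \<subseteq> A}"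

text \<open>The ideal \<open>r(L, M)\<close>; the union is over \<open>k \<ge> 1\<close>.\<close>

definition rr_ideal ::
  "('a, 'r) ring_scheme \<Rightarrow> ('a, 'b, 'm) module_scheme \<Rightarrow> 'a set \<Rightarrow> 'a set"
  where "rr_ideal R M L =
    (\<Union>k \<in> {1..}. submodule_colon R M
       (ideal_smult R M (ideal_pow R L (k + 1))) (ideal_smult R M (ideal_pow R L k)))"

definition ideal_filtration :: "('a, 'r) ring_scheme \<Rightarrow> (nat \<Rightarrow> 'a set) \<Rightarrow> bool"
  where "ideal_filtration R F \<longleftrightarrow>
    (\<forall>n. ideal (F n) R) \<and> F 0 = carrier R \<and> (\<forall>n. F (n + 1) \<subseteq> F n) \<and>
    (\<forall>n m. F n \<cdot>\<^bsub>R\<^esub> F m \<subseteq> F (n + m))"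

definition I_filtration :: "('a, 'r) ring_scheme \<Rightarrow> 'a set \<Rightarrow> (nat \<Rightarrow> 'a set) \<Rightarrow> bool"
  where "I_filtration R I F \<longleftrightarrow>
    ideal_filtration R F \<and> (\<forall>n. I \<cdot>\<^bsub>R\<^esub> F n \<subseteq> F (n + 1))"

end

theory Submission
  imports Defs
begin

text \<open>Write \<open>N m\<close> for \<open>I\<^sup>mM\<close>.  The colon ideals \<open>(N (m + n) : N m)\<close> grow with \<open>m\<close>: if
  \<open>x N m \<subseteq> N (m + n)\<close>, then multiplying by \<open>I\<close> gives \<open>x N (m + 1) \<subseteq> N (m + 1 + n)\<close>.  The union
  defining \<open>r(I\<^sup>n, M)\<close> only uses the indices \<open>m = nk\<close> with \<open>k \<ge> 1\<close>, but these are cofinal when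
  \<open>n \<ge> 1\<close>, while for \<open>n = 0\<close> every colon ideal is the whole ring.  Hence, uniformly in \<open>n\<close>,
  \<open>r(I\<^sup>n, M)\<close> consists of the \<open>x\<close> with \<open>x N m \<subseteq> N (m + n)\<close> for some \<open>m\<close>, equivalently for all
  large \<open>m\<close> (lemmas \<open>shift_mono\<close> and \<open>mem_rr_ideal_power_iff\<close>).

  In other words \<open>r(I\<^sup>n, M)\<close> consists of the ring elements that raise the degree of the filtration
  \<open>N\<close> by at least \<open>n\<close> eventually.  From this reading everything follows: such elements form an
  ideal, raising by \<open>n + 1\<close> implies raising by \<open>n\<close>, and a composite raises by the sum of the
  degrees.  Finally an element of \<open>I\<close> raises the degree by one, so \<open>I \<subseteq> r(I, M)\<close>, and the
  \<open>I\<close>-filtration property is a special case of multiplicativity.\<close>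

section \<open>Multiples of a module by ideals\<close>

context module
begin

lemma submodule_Inter:
  assumes "\<S> \<noteq> {}" and "\<And>N. N \<in> \<S> \<Longrightarrow> submodule N R M"
  shows "submodule (\<Inter>\<S>) R M"
proof (rule submoduleI)
  show "\<Inter>\<S> \<subseteq> carrier M"
    using assms submoduleE(1) by blast
  show "\<zero>\<^bsub>M\<^esub> \<in> \<Inter>\<S>"
  proof
    fix N assume "N \<in> \<S>"
    then interpret submodule N R M by (rule assms(2))
    show "\<zero>\<^bsub>M\<^esub> \<in> N" using one_closed by simp
  qed
qed (auto dest: assms(2) intro: submoduleE)

lemma submodule_gen_submodule:
  assumes "S \<subseteq> carrier M"
  shows "submodule (gen_submodule R M S) R M"
  unfolding gen_submodule_def
  using assms carrier_is_submodule by (intro submodule_Inter) auto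

lemma submodule_ideal_smult:
  assumes "ideal L R"
  shows "submodule (ideal_smult R M L) R M"
  unfolding ideal_smult_def
  using ideal.Icarr[OF assms] by (intro submodule_gen_submodule) auto

lemma ideal_smultI:
  assumes "a \<in> L" and "x \<in> carrier M"
  shows "a \<odot>\<^bsub>M\<^esub> x \<in> ideal_smult R M L"
  using assms unfolding ideal_smult_def gen_submodule_def by blast

lemma ideal_smult_least:
  assumes "submodule P R M" and "\<And>a x. a \<in> L \<Longrightarrow> x \<in> carrier M \<Longrightarrow> a \<odot>\<^bsub>M\<^esub> x \<in> P"
  shows "ideal_smult R M L \<subseteq> P"
  using assms unfolding ideal_smult_def gen_submodule_def by blast

text \<open>Preimages under a homothety turn an inclusion \<open>x N \<subseteq> P\<close> into an inclusion of submodules, so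
  that it can be tested on generators of \<open>N\<close>.\<close>

lemma submodule_homothety_vimage:
  assumes "submodule P R M" and "x \<in> carrier R"
  shows "submodule {y \<in> carrier M. x \<odot>\<^bsub>M\<^esub> y \<in> P} R M"
proof -
  interpret P: submodule P R M by (rule assms(1))
  have smult: "x \<odot>\<^bsub>M\<^esub> (a \<odot>\<^bsub>M\<^esub> y) \<in> P"
    if "a \<in> carrier R" "y \<in> carrier M" "x \<odot>\<^bsub>M\<^esub> y \<in> P" for a y
  proof -
    have "x \<odot>\<^bsub>M\<^esub> (a \<odot>\<^bsub>M\<^esub> y) = a \<odot>\<^bsub>M\<^esub> (x \<odot>\<^bsub>M\<^esub> y)"
      using that assms(2) by (metis smult_assoc1 R.m_comm)
    then show ?thesis
      using that by simp
  qed
  show ?thesis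
    using assms P.one_closed
    by (intro submoduleI) (auto simp: smult smult_r_minus smult_r_distr submoduleE)
qed

lemma ideal_smult_prodI:
  assumes "ideal J R" and "ideal K R" and "a \<in> J" and "y \<in> ideal_smult R M K"
  shows "a \<odot>\<^bsub>M\<^esub> y \<in> ideal_smult R M (J \<cdot> K)"
proof -
  have a: "a \<in> carrier R"
    using assms(1,3) by (rule ideal.Icarr)
  have "ideal_smult R M K \<subseteq> {y \<in> carrier M. a \<odot>\<^bsub>M\<^esub> y \<in> ideal_smult R M (J \<cdot> K)}"
  proof (rule ideal_smult_least)
    show "submodule {y \<in> carrier M. a \<odot>\<^bsub>M\<^esub> y \<in> ideal_smult R M (J \<cdot> K)} R M"
      using a assms(1,2)
      by (intro submodule_homothety_vimage submodule_ideal_smult ideal_prod_is_ideal)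
    fix b x assume b: "b \<in> K" and x: "x \<in> carrier M"
    have "b \<in> carrier R"
      using assms(2) b by (rule ideal.Icarr)
    moreover have "(a \<otimes> b) \<odot>\<^bsub>M\<^esub> x \<in> ideal_smult R M (J \<cdot> K)"
      using assms(3) b x by (intro ideal_smultI ideal_prod.prod)
    ultimately show "b \<odot>\<^bsub>M\<^esub> x \<in> {y \<in> carrier M. a \<odot>\<^bsub>M\<^esub> y \<in> ideal_smult R M (J \<cdot> K)}"
      using a x by (simp add: smult_assoc1)
  qed
  with assms(4) show ?thesis
    by blast
qed

lemma ideal_smult_prod_least:
  assumes "ideal J R" and "ideal K R" and P: "submodule P R M"
    and le: "\<And>a y. a \<in> J \<Longrightarrow> y \<in> ideal_smult R M K \<Longrightarrow> a \<odot>\<^bsub>M\<^esub> y \<in> P"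
  shows "ideal_smult R M (J \<cdot> K) \<subseteq> P"
proof (rule ideal_smult_least[OF P])
  fix c x assume "c \<in> J \<cdot> K" and x: "x \<in> carrier M"
  then show "c \<odot>\<^bsub>M\<^esub> x \<in> P"
  proof (induction c rule: ideal_prod.induct)
    case (prod a b)
    then show ?case
      using assms(1,2) le[of a "b \<odot>\<^bsub>M\<^esub> x"] by (simp add: smult_assoc1 ideal.Icarr ideal_smultI)
  next
    case (sum c d)
    then have "c \<in> carrier R" "d \<in> carrier R"
      using ideal_prod_in_carrier[OF assms(1,2)] by auto
    then show ?case
      using sum x by (simp add: smult_l_distr submoduleE(5)[OF P])
  qed
qed

section \<open>Elements shifting the adic filtration\<close>

lemma ideal_pow_0: "ideal_pow R I 0 = carrier R"
  by (simp add: ideal_pow_def ideals_set_def nat_pow_def)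

lemma ideal_ideal_pow:
  assumes "ideal I R"
  shows "ideal (ideal_pow R I n) R"
proof -
  interpret S: comm_monoid "ideals_set R" by (rule ideals_set_is_comm_monoid)
  show ?thesis
    using S.nat_pow_closed[of I n] assms by (simp add: ideal_pow_def ideals_set_def)
qed

lemma ideal_pow_Suc:
  assumes "ideal I R"
  shows "ideal_pow R I (Suc n) = I \<cdot> ideal_pow R I n"
proof -
  interpret S: comm_monoid "ideals_set R" by (rule ideals_set_is_comm_monoid)
  show ?thesis
    using S.nat_pow_Suc2[of I n] assms by (simp add: ideal_pow_def ideals_set_def)
qed

lemma ideal_pow_pow:
  assumes "ideal I R"
  shows "ideal_pow R (ideal_pow R I n) k = ideal_pow R I (n * k)"
proof -
  interpret S: comm_monoid "ideals_set R" by (rule ideals_set_is_comm_monoid)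
  show ?thesis
    using S.nat_pow_pow[of I n k] assms by (simp add: ideal_pow_def ideals_set_def)
qed

abbreviation adic :: "'a set \<Rightarrow> nat \<Rightarrow> 'c set"
  where "adic I m \<equiv> ideal_smult R M (ideal_pow R I m)"

text \<open>The ring elements that take \<open>I\<^sup>mM\<close>, and hence every later term, at least \<open>n\<close> steps further
  down the filtration.\<close>

abbreviation shift :: "'a set \<Rightarrow> nat \<Rightarrow> nat \<Rightarrow> 'a set"
  where "shift I n m \<equiv> submodule_colon R M (adic I (m + n)) (adic I m)"

lemma submodule_adic: "ideal I R \<Longrightarrow> submodule (adic I m) R M"
  by (intro submodule_ideal_smult ideal_ideal_pow)

lemma adic_carrier: "ideal I R \<Longrightarrow> y \<in> adic I m \<Longrightarrow> y \<in> carrier M"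
  using submodule_adic submoduleE(1) by blast

lemma smult_adic_Suc:
  assumes "ideal I R" and "a \<in> I" and "y \<in> adic I m"
  shows "a \<odot>\<^bsub>M\<^esub> y \<in> adic I (Suc m)"
  using assms by (simp add: ideal_pow_Suc ideal_smult_prodI ideal_ideal_pow)

lemma adic_Suc_subset:
  assumes "ideal I R"
  shows "adic I (Suc m) \<subseteq> adic I m"
  unfolding ideal_pow_Suc[OF assms]
  using assms
  by (intro ideal_smult_prod_least ideal_ideal_pow submodule_adic)
    (auto intro: submoduleE(4)[OF submodule_adic] ideal.Icarr)

lemma shift_Suc:
  assumes I: "ideal I R" and x: "x \<in> shift I n m"
  shows "x \<in> shift I n (Suc m)"
  \<comment> \<open>Homotheties commute, so \<open>x (a y) = a (x y)\<close> for the generators \<open>a y\<close> of \<open>I (I\<^sup>mM)\<close>.\<close>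
proof -
  have xR: "x \<in> carrier R" and xN: "\<And>y. y \<in> adic I m \<Longrightarrow> x \<odot>\<^bsub>M\<^esub> y \<in> adic I (m + n)"
    using x by (auto simp: submodule_colon_def)
  have "adic I (Suc m) \<subseteq> {y \<in> carrier M. x \<odot>\<^bsub>M\<^esub> y \<in> adic I (Suc m + n)}"
    unfolding ideal_pow_Suc[OF I, of m]
  proof (rule ideal_smult_prod_least)
    show "submodule {y \<in> carrier M. x \<odot>\<^bsub>M\<^esub> y \<in> adic I (Suc m + n)} R M"
      using I xR by (intro submodule_homothety_vimage submodule_adic)
    fix a y assume a: "a \<in> I" and y: "y \<in> adic I m"
    have "x \<odot>\<^bsub>M\<^esub> (a \<odot>\<^bsub>M\<^esub> y) = a \<odot>\<^bsub>M\<^esub> (x \<odot>\<^bsub>M\<^esub> y)"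
      using xR ideal.Icarr[OF I a] adic_carrier[OF I y] by (metis smult_assoc1 R.m_comm)
    also have "\<dots> \<in> adic I (Suc m + n)"
      using smult_adic_Suc[OF I a xN[OF y]] by simp
    finally show "a \<odot>\<^bsub>M\<^esub> y \<in> {y \<in> carrier M. x \<odot>\<^bsub>M\<^esub> y \<in> adic I (Suc m + n)}"
      using ideal.Icarr[OF I a] adic_carrier[OF I y] by simp
  qed (use I ideal_ideal_pow in auto)
  then show ?thesis
    using xR by (auto simp: submodule_colon_def)
qed

lemma shift_mono:
  assumes "ideal I R" and "m \<le> m'" and "x \<in> shift I n m"
  shows "x \<in> shift I n m'"
  using assms(2,3)
  by (induction m' rule: dec_induct) (auto simp only: shift_Suc[OF assms(1)])

text \<open>Since the ideals \<open>(I\<^sup>m\<^sup>+\<^sup>nM : I\<^sup>mM)\<close> grow with \<open>m\<close>, for \<open>n \<ge> 1\<close> a union over the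
  multiples \<open>m = nk\<close> is the union over all \<open>m\<close>; for \<open>n = 0\<close> both are the whole ring.
  In this form the parameters \<open>m\<close> for different degrees can be compared, which is what makes sums and products tractable.\<close>

lemma mem_rr_ideal_power_iff:
  assumes I: "ideal I R"
  shows "x \<in> rr_ideal R M (ideal_pow R I n) \<longleftrightarrow> (\<exists>m. x \<in> shift I n m)"
proof
  assume "x \<in> rr_ideal R M (ideal_pow R I n)"
  then obtain k where "x \<in> shift I n (n * k)"
    unfolding rr_ideal_def by (auto simp: ideal_pow_pow[OF I] algebra_simps)
  then show "\<exists>m. x \<in> shift I n m" ..
next
  assume "\<exists>m. x \<in> shift I n m"
  then obtain m where m: "x \<in> shift I n m" ..
  have "x \<in> shift I n (n * Suc m)"
  proof (cases "n = 0")
    case True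
    \<comment> \<open>The multiples of \<open>0\<close> never reach \<open>m\<close>, but a submodule is stable under every homothety.\<close>
    with m show ?thesis
      by (auto simp: submodule_colon_def intro: submoduleE(4)[OF submodule_adic[OF I]])
  next
    case False
    then have "1 * m \<le> n * Suc m"
      by (intro mult_le_mono) auto
    then have "m \<le> n * Suc m"
      by simp
    then show ?thesis
      using shift_mono[OF I _ m] by blast
  qed
  then have "x \<in> submodule_colon R M
      (ideal_smult R M (ideal_pow R (ideal_pow R I n) (Suc m + 1)))
      (ideal_smult R M (ideal_pow R (ideal_pow R I n) (Suc m)))"
    by (simp add: ideal_pow_pow[OF I] algebra_simps)
  then show "x \<in> rr_ideal R M (ideal_pow R I n)"
    unfolding rr_ideal_def by (intro UN_I[of "Suc m"]) auto
qed

section \<open>The filtration\<close>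

lemma ideal_submodule_colon:
  assumes A: "submodule A R M" and B: "submodule B R M"
  shows "ideal (submodule_colon R M A B) R"
proof (rule idealI)
  show "ring R" ..
  have BM: "\<And>b. b \<in> B \<Longrightarrow> b \<in> carrier M"
    using submoduleE(1)[OF B] by blast
  interpret A: submodule A R M by (rule A)
  show "subgroup (submodule_colon R M A B) (add_monoid R)"
    using A.one_closed BM
    by (intro R.add.subgroupI)
      (auto simp: submodule_colon_def image_subset_iff smult_l_distr smult_l_minus submoduleE[OF A]
         intro!: exI[of _ \<zero>])
  show xa: "x \<otimes> a \<in> submodule_colon R M A B"
    if "a \<in> submodule_colon R M A B" "x \<in> carrier R" for a x
    using that BM by (auto simp: submodule_colon_def smult_assoc1)
  show "a \<otimes> x \<in> submodule_colon R M A B"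
    if "a \<in> submodule_colon R M A B" "x \<in> carrier R" for a x
    using xa[OF that] that by (simp add: submodule_colon_def R.m_comm)
qed

lemma ideal_rr_ideal_power:
  assumes I: "ideal I R"
  shows "ideal (rr_ideal R M (ideal_pow R I n)) R"
proof -
  have id: "ideal (shift I n m) R" for m
    using I by (intro ideal_submodule_colon submodule_adic)
  show ?thesis
  proof (rule idealI)
    show "ring R" ..
    show "subgroup (rr_ideal R M (ideal_pow R I n)) (add_monoid R)"
    proof (rule R.add.subgroupI)
      show "rr_ideal R M (ideal_pow R I n) \<subseteq> carrier R"
        by (auto simp: rr_ideal_def submodule_colon_def)
      have "\<zero> \<in> shift I n 0"
        by (rule additive_subgroup.zero_closed[OF ideal.axioms(1)[OF id]])
      then show "rr_ideal R M (ideal_pow R I n) \<noteq> {}"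
        using mem_rr_ideal_power_iff[OF I] by blast
    next
      fix x assume "x \<in> rr_ideal R M (ideal_pow R I n)"
      then obtain m where "x \<in> shift I n m"
        unfolding mem_rr_ideal_power_iff[OF I] ..
      then have "\<ominus> x \<in> shift I n m"
        by (rule additive_subgroup.a_inv_closed[OF ideal.axioms(1)[OF id]])
      then show "\<ominus> x \<in> rr_ideal R M (ideal_pow R I n)"
        unfolding mem_rr_ideal_power_iff[OF I] ..
    next
      fix x y
      assume "x \<in> rr_ideal R M (ideal_pow R I n)" "y \<in> rr_ideal R M (ideal_pow R I n)"
      then obtain m m' where "x \<in> shift I n m" "y \<in> shift I n m'"
        unfolding mem_rr_ideal_power_iff[OF I] by blast
      then have "x \<in> shift I n (max m m')" "y \<in> shift I n (max m m')"
        using shift_mono[OF I] by (meson max.cobounded1 max.cobounded2)+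
      then have "x \<oplus> y \<in> shift I n (max m m')"
        by (rule additive_subgroup.a_closed[OF ideal.axioms(1)[OF id]])
      then show "x \<oplus> y \<in> rr_ideal R M (ideal_pow R I n)"
        unfolding mem_rr_ideal_power_iff[OF I] ..
    qed
  next
    fix a x assume "a \<in> rr_ideal R M (ideal_pow R I n)" "x \<in> carrier R"
    then show "x \<otimes> a \<in> rr_ideal R M (ideal_pow R I n)" "a \<otimes> x \<in> rr_ideal R M (ideal_pow R I n)"
      unfolding mem_rr_ideal_power_iff[OF I]
      using ideal.I_l_closed[OF id] ideal.I_r_closed[OF id] by blast+
  qed
qed

lemma rr_ideal_power_0:
  assumes I: "ideal I R"
  shows "rr_ideal R M (ideal_pow R I 0) = carrier R"
proof
  show "rr_ideal R M (ideal_pow R I 0) \<subseteq> carrier R"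
    by (auto simp: rr_ideal_def submodule_colon_def)
  show "carrier R \<subseteq> rr_ideal R M (ideal_pow R I 0)"
  proof
    fix x assume "x \<in> carrier R"
    then have "x \<in> shift I 0 0"
      by (auto simp: submodule_colon_def intro: submoduleE(4)[OF submodule_adic[OF I]])
    then show "x \<in> rr_ideal R M (ideal_pow R I 0)"
      unfolding mem_rr_ideal_power_iff[OF I] ..
  qed
qed

lemma rr_ideal_power_Suc_subset:
  assumes I: "ideal I R"
  shows "rr_ideal R M (ideal_pow R I (Suc n)) \<subseteq> rr_ideal R M (ideal_pow R I n)"
proof
  fix x assume "x \<in> rr_ideal R M (ideal_pow R I (Suc n))"
  then obtain m where "x \<in> shift I (Suc n) m"
    unfolding mem_rr_ideal_power_iff[OF I] ..
  then have "x \<in> shift I n m"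
    using adic_Suc_subset[OF I, of "m + n"] by (auto simp: submodule_colon_def)
  then show "x \<in> rr_ideal R M (ideal_pow R I n)"
    unfolding mem_rr_ideal_power_iff[OF I] ..
qed

lemma mult_mem_rr_ideal_power:
  assumes I: "ideal I R"
    and "x \<in> rr_ideal R M (ideal_pow R I n)" and "y \<in> rr_ideal R M (ideal_pow R I n')"
  shows "x \<otimes> y \<in> rr_ideal R M (ideal_pow R I (n + n'))"
proof -
  obtain m m' where "x \<in> shift I n m" and y: "y \<in> shift I n' m'"
    using assms(2,3) unfolding mem_rr_ideal_power_iff[OF I] by blast
  \<comment> \<open>Start high enough that \<open>x\<close> shifts the degree which \<open>y\<close> leads to.\<close>
  then have "x \<in> shift I n (max m m' + n')" "y \<in> shift I n' (max m m')"
    using shift_mono[OF I] by (meson max.cobounded1 max.cobounded2 trans_le_add1)+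
  then have "x \<otimes> y \<in> shift I (n + n') (max m m')"
    using adic_carrier[OF I] by (auto simp: submodule_colon_def image_subset_iff smult_assoc1 ac_simps)
  then show ?thesis
    unfolding mem_rr_ideal_power_iff[OF I] ..
qed

lemma rr_ideal_power_prod_subset:
  assumes I: "ideal I R"
  shows "rr_ideal R M (ideal_pow R I n) \<cdot> rr_ideal R M (ideal_pow R I n')
    \<subseteq> rr_ideal R M (ideal_pow R I (n + n'))"
proof
  fix s assume "s \<in> rr_ideal R M (ideal_pow R I n) \<cdot> rr_ideal R M (ideal_pow R I n')"
  then show "s \<in> rr_ideal R M (ideal_pow R I (n + n'))"
    by (induction rule: ideal_prod.induct)
      (auto intro: mult_mem_rr_ideal_power[OF I]
         additive_subgroup.a_closed[OF ideal.axioms(1)[OF ideal_rr_ideal_power[OF I]]])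
qed

lemma ideal_subset_rr_ideal_power_1:
  assumes I: "ideal I R"
  shows "I \<subseteq> rr_ideal R M (ideal_pow R I 1)"
proof
  fix x assume x: "x \<in> I"
  then have "x \<in> shift I 1 0"
    using smult_adic_Suc[OF I x, of _ 0] ideal.Icarr[OF I x] by (auto simp: submodule_colon_def)
  then show "x \<in> rr_ideal R M (ideal_pow R I 1)"
    unfolding mem_rr_ideal_power_iff[OF I] ..
qed

lemma I_filtration_rr_ideal_power:
  assumes I: "ideal I R"
  shows "I_filtration R I (\<lambda>n. rr_ideal R M (ideal_pow R I n))"
proof -
  have "ideal_filtration R (\<lambda>n. rr_ideal R M (ideal_pow R I n))"
    using ideal_rr_ideal_power[OF I] rr_ideal_power_0[OF I] rr_ideal_power_Suc_subset[OF I]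
      rr_ideal_power_prod_subset[OF I]
    by (simp add: ideal_filtration_def)
  moreover have "I \<cdot> rr_ideal R M (ideal_pow R I n) \<subseteq> rr_ideal R M (ideal_pow R I (n + 1))" for n
  proof
    fix s assume "s \<in> I \<cdot> rr_ideal R M (ideal_pow R I n)"
    then have "s \<in> rr_ideal R M (ideal_pow R I 1) \<cdot> rr_ideal R M (ideal_pow R I n)"
      by (induction rule: ideal_prod.induct)
        (use ideal_subset_rr_ideal_power_1[OF I] in \<open>auto intro: ideal_prod.intros\<close>)
    then show "s \<in> rr_ideal R M (ideal_pow R I (n + 1))"
      using rr_ideal_power_prod_subset[OF I, of 1 n] by (auto simp: add.commute)
  qed
  ultimately show ?thesis
    by (simp add: I_filtration_def)
qed

end

theorem theorem2p1:
  fixes R :: "('a, 'r) ring_scheme"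
    and M :: "('a, 'b, 'm) module_scheme"
    and I :: "'a set"
  assumes "cring R" and "noetherian_ring R"
    and "ideal I R"
    and "module R M" and "fin_gen_module R M"
  shows "ideal_filtration R (\<lambda>n. rr_ideal R M (ideal_pow R I n))
    \<and> I_filtration R I (\<lambda>n. rr_ideal R M (ideal_pow R I n))"
  using module.I_filtration_rr_ideal_power[OF assms(4,3)] by (simp add: I_filtration_def)

end
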